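(* Let $G$ be a finite abelian group which is not simple. Then no nontrivial proper subgroup of $G$ is a perfect code of $G$ if and only if $G$ is isomorphic to the cyclic group $\mathbb{Z}_{2^m}$ for some $m\ge 2$.
   Context: For a group $G$ and an inverse-closed subset $S\subseteq G$ with $e\notin S$, the Cayley graph $\mathrm{Cay}(G,S)$ has vertex set $G$, with distinct $x,y$ adjacent iff $yx^{-1}\in S$. A subset $C$ of the vertex set of a graph is a perfect code if it is independent and every vertex outside $C$ is adjacent to exactly one vertex of $C$. A subset $C$ of $G$ is a perfect code of $G$ if some Cayley graph $\mathrm{Cay}(G,S)$ admits $C$ as a perfect code.
   Formalization: The group G is additionally assumed to be nontrivial: the trivial group counts as not simple and has no nontrivial proper subgroup, yet is not isomorphic to any cyclic group of order 2^m with m at least 2. *)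

theory Defs
  imports
    "HOL-Algebra.SimpleGroups"
    "HOL-Algebra.Elementary_Groups"
    "Graph_Theory.Pair_Digraph"
begin

text \<open>Undirected simple graphs are rendered as symmetric loop-free digraphs without parallel arcs,
  the convention of the Graph Theory library; adjacency of \<open>u\<close> and \<open>v\<close> is
  \<open>u \<rightarrow>\<^bsub>\<Gamma>\<^esub> v\<close>. The lemma \<open>pair_bidirected_digraph_cayley_graph\<close> shows that Cayley graphs
  are of this kind.\<close>

definition connection_set :: "('a, 'b) monoid_scheme \<Rightarrow> 'a set \<Rightarrow> bool" where
  "connection_set G S \<longleftrightarrow>
     S \<subseteq> carrier G \<and> (\<forall>s\<in>S. inv\<^bsub>G\<^esub> s \<in> S) \<and> \<one>\<^bsub>G\<^esub> \<notin> S"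

definition cayley_graph :: "('a, 'b) monoid_scheme \<Rightarrow> 'a set \<Rightarrow> 'a pair_pre_digraph" where
  "cayley_graph G S =
     \<lparr> pverts = carrier G,
       parcs = {(x, y). x \<in> carrier G \<and> y \<in> carrier G \<and> x \<noteq> y \<and> y \<otimes>\<^bsub>G\<^esub> inv\<^bsub>G\<^esub> x \<in> S} \<rparr>"

definition independent_vertices :: "('a, 'b) pre_digraph \<Rightarrow> 'a set \<Rightarrow> bool" where
  "independent_vertices \<Gamma> C \<longleftrightarrow>
     C \<subseteq> verts \<Gamma> \<and> (\<forall>u\<in>C. \<forall>v\<in>C. \<not> u \<rightarrow>\<^bsub>\<Gamma>\<^esub> v)"

definition graph_perfect_code :: "('a, 'b) pre_digraph \<Rightarrow> 'a set \<Rightarrow> bool" where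
  "graph_perfect_code \<Gamma> C \<longleftrightarrow>
     independent_vertices \<Gamma> C \<and> (\<forall>v\<in>verts \<Gamma> - C. \<exists>!c. c \<in> C \<and> v \<rightarrow>\<^bsub>\<Gamma>\<^esub> c)"

definition group_perfect_code :: "('a, 'b) monoid_scheme \<Rightarrow> 'a set \<Rightarrow> bool" where
  "group_perfect_code G C \<longleftrightarrow>
     (\<exists>S. connection_set G S \<and> graph_perfect_code (with_proj (cayley_graph G S)) C)"

lemma (in group) pair_bidirected_digraph_cayley_graph:
  assumes "connection_set G S"
  shows "pair_bidirected_digraph (cayley_graph G S)"
proof -
  have "x \<otimes> inv y \<in> S" if "x \<in> carrier G" "y \<in> carrier G" "y \<otimes> inv x \<in> S" for x y
  proof -
    have "inv (y \<otimes> inv x) \<in> S"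
      using assms that by (simp add: connection_set_def)
    then show ?thesis
      using that by (simp add: inv_mult_group)
  qed
  then show ?thesis
    by unfold_locales (auto simp: cayley_graph_def symmetric_def sym_def)
qed

end

theory Submission
  imports Defs "HOL-Algebra.Multiplicative_Group"
begin

text \<open>A subgroup \<open>H\<close> of a finite abelian group is a perfect code iff every coset \<open>g H\<close> with
  \<open>g\<^sup>2 \<in> H\<close> contains an element whose square is trivial. This holds whenever \<open>H\<close> has odd order,
  and in a 2-group whenever \<open>H\<close> is generated by an element of maximal order. So if there is no
  nontrivial proper perfect code, no element has odd order greater than 1, and an element of
  maximal order generates the group. Conversely, in a cyclic 2-group the only involution lies in
  every nontrivial subgroup, so the criterion fails for every proper one.\<close>

section \<open>Subgroup perfect codes and involutions in cosets\<close>

lemma (in group) adj_cayley_graph: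
  "u \<rightarrow>\<^bsub>with_proj (cayley_graph G S)\<^esub> v \<longleftrightarrow>
     u \<in> carrier G \<and> v \<in> carrier G \<and> u \<noteq> v \<and> v \<otimes> inv u \<in> S"
  by (simp add: cayley_graph_def)

text \<open>If \<open>c\<close> is the only neighbour of \<open>g\<close> in \<open>H\<close>, then
  \<open>S\<close> contains \<open>c \<otimes> inv g\<close> and hence its inverse, which leads from
  \<open>g\<close> to \<open>d\<close>, equal to \<open>g \<otimes> g \<otimes> inv c\<close> and so
  again in \<open>H\<close>. Uniqueness forces \<open>d = c\<close>, so \<open>g\<close> and
  \<open>c\<close> have the same square and \<open>inv c\<close> is the witness.\<close>

lemma (in comm_group) perfect_code_imp_involution_in_coset:
  assumes H: "subgroup H G" and pc: "group_perfect_code G H"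
    and g: "g \<in> carrier G" "g \<otimes> g \<in> H"
  shows "\<exists>h\<in>H. (g \<otimes> h) \<otimes> (g \<otimes> h) = \<one>"
proof -
  interpret H: subgroup H G by fact
  show ?thesis
  proof (cases "g \<in> H")
    case True
    then show ?thesis
      using g by (intro bexI[of _ "inv g"]) auto
  next
    case False
    obtain S where S: "connection_set G S"
      and code: "graph_perfect_code (with_proj (cayley_graph G S)) H"
      using pc by (auto simp: group_perfect_code_def)
    have "\<exists>!c. c \<in> H \<and> g \<rightarrow>\<^bsub>with_proj (cayley_graph G S)\<^esub> c"
      using code g False by (auto simp: graph_perfect_code_def cayley_graph_def)
    then obtain c where c: "c \<in> H" "c \<otimes> inv g \<in> S"
      and uniq: "\<And>d. d \<in> H \<Longrightarrow> d \<otimes> inv g \<in> S \<Longrightarrow> d = c"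
      using g False unfolding adj_cayley_graph by (metis H.mem_carrier)
    have cc: "c \<in> carrier G"
      using c by simp
    define d where "d = (g \<otimes> inv c) \<otimes> g"
    have "inv (c \<otimes> inv g) \<in> S"
      using S c by (simp add: connection_set_def)
    moreover have "d \<otimes> inv g = inv (c \<otimes> inv g)"
      using g cc by (simp add: d_def inv_mult_group m_assoc)
    moreover have "d = (g \<otimes> g) \<otimes> inv c"
      using g cc by (simp add: d_def m_ac)
    ultimately have "d = c"
      using c g by (intro uniq) auto
    then have gg: "g \<otimes> g = c \<otimes> c"
      using g cc \<open>d = (g \<otimes> g) \<otimes> inv c\<close> by (metis inv_solve_right m_closed)
    have "(g \<otimes> inv c) \<otimes> (g \<otimes> inv c) = (g \<otimes> g) \<otimes> inv (c \<otimes> c)"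
      using g cc by (simp add: inv_mult m_ac)
    also have "\<dots> = \<one>"
      using g cc gg by simp
    finally show ?thesis
      using c by blast
  qed
qed

text \<open>A maximal inverse-closed set avoiding \<open>H\<close> and meeting every coset at most once meets every
  coset other than \<open>H\<close>: a missed coset can be served by a self-inverse
  element, or, together with the inverse coset, by a pair of mutually inverse elements.\<close>

lemma (in comm_group) involution_in_cosets_imp_perfect_code:
  assumes fin: "finite (carrier G)" and H: "subgroup H G"
    and inv_coset: "\<And>g. g \<in> carrier G \<Longrightarrow> g \<otimes> g \<in> H \<Longrightarrow> \<exists>h\<in>H. (g \<otimes> h) \<otimes> (g \<otimes> h) = \<one>"
  shows "group_perfect_code G H"
proof -
  interpret H: subgroup H G by fact
  define adm where "adm S \<longleftrightarrow> S \<subseteq> carrier G - H \<and> (\<forall>s\<in>S. inv s \<in> S) \<and>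
      (\<forall>s\<in>S. \<forall>t\<in>S. s \<otimes> inv t \<in> H \<longrightarrow> s = t)" for S
  have "finite {S. adm S}"
    by (rule finite_subset[of _ "Pow (carrier G)"]) (auto simp: adm_def fin)
  moreover have "adm {}"
    by (simp add: adm_def)
  ultimately obtain S where S: "adm S" and maximal: "\<And>T. adm T \<Longrightarrow> S \<subseteq> T \<Longrightarrow> S = T"
    using finite_has_maximal[of "{S. adm S}"] by blast
  have ScH: "s \<in> carrier G" "s \<notin> H" if "s \<in> S" for s
    using S that by (auto simp: adm_def)
  have Sinv: "inv s \<in> S" if "s \<in> S" for s
    using S that by (auto simp: adm_def)
  have Suniq: "s = t" if "s \<in> S" "t \<in> S" "s \<otimes> inv t \<in> H" for s t
    using S that by (auto simp: adm_def)
  have swap: "t \<otimes> inv s \<in> H" if "s \<otimes> inv t \<in> H" "s \<in> carrier G" "t \<in> carrier G" for s t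
    using H.m_inv_closed[OF that(1)] that by (simp add: inv_mult_group)
  \<comment> \<open>If \<open>x \<otimes> x\<close> is in \<open>H\<close>, then \<open>x\<close>
    and \<open>inv x\<close> lie in the same coset. Adding both keeps one element per coset only
    when they coincide, which is what \<open>xx\<close> guarantees.\<close>
  have add_pair: "x \<in> S" if x: "x \<in> carrier G" "x \<notin> H" and miss: "\<And>s. s \<in> S \<Longrightarrow> s \<otimes> inv x \<notin> H"
    and xx: "x \<otimes> x \<in> H \<Longrightarrow> inv x = x" for x
  proof -
    \<comment> \<open>Since \<open>S\<close> is closed under inverses, a missed coset of
      \<open>x\<close> means that the coset of \<open>inv x\<close> is missed too.\<close>
    have miss': "s \<otimes> x \<notin> H" if "s \<in> S" for s
    proof
      assume "s \<otimes> x \<in> H"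
      then have "inv (s \<otimes> x) \<in> H"
        by simp
      then have "inv s \<otimes> inv x \<in> H"
        using x ScH that by (simp add: inv_mult)
      then show False
        using miss[OF Sinv[OF that]] by simp
    qed
    have miss2: "x \<otimes> inv s \<notin> H" if "s \<in> S" for s
      using swap[of x s] miss[OF that] x ScH[OF that] by blast
    have miss3: "inv x \<otimes> inv s \<notin> H" if "s \<in> S" for s
      using swap[of "inv x" s] miss'[OF that] x ScH[OF that] by auto
    have invx: "inv x \<notin> H"
      using x by (metis H.m_inv_closed inv_inv)
    have xx': "inv x = x" if "inv x \<otimes> inv x \<in> H"
      using xx swap[of "inv x" x] that x by auto
    have "adm (insert x (insert (inv x) S))"
      unfolding adm_def using x ScH Sinv Suniq miss miss' miss2 miss3 invx xx xx' by auto
    from maximal[OF this] show ?thesis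
      by blast
  qed
  have exS: "\<exists>s\<in>S. s \<otimes> inv x \<in> H" if x: "x \<in> carrier G" "x \<notin> H" for x
  proof (rule ccontr)
    assume "\<not> ?thesis"
    then have miss: "\<And>s. s \<in> S \<Longrightarrow> s \<otimes> inv x \<notin> H"
      by blast
    \<comment> \<open>The coset of \<open>x\<close> gets the representative
      \<open>x \<otimes> h\<close>: a self-inverse one if \<open>x \<otimes> x\<close> is in
      \<open>H\<close>, and otherwise \<open>x\<close> itself, where the implication is
      vacuous.\<close>
    obtain h where h: "h \<in> H" and xh: "(x \<otimes> h) \<otimes> (x \<otimes> h) \<in> H \<Longrightarrow> inv (x \<otimes> h) = x \<otimes> h"
    proof (cases "x \<otimes> x \<in> H")
      case True
      then obtain h where "h \<in> H" "(x \<otimes> h) \<otimes> (x \<otimes> h) = \<one>"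
        using inv_coset x by blast
      then show ?thesis
        using x by (intro that[of h]) (auto intro: inv_equality)
    next
      case False
      then show ?thesis
        using x by (intro that[of \<one>]) auto
    qed
    have xhH: "x \<otimes> h \<notin> H"
      using x h by (metis H.m_closed H.m_inv_closed H.mem_carrier inv_solve_right m_closed)
    have "s \<otimes> inv (x \<otimes> h) \<notin> H" if "s \<in> S" for s
    proof
      assume "s \<otimes> inv (x \<otimes> h) \<in> H"
      then have "s \<otimes> inv (x \<otimes> h) \<otimes> h \<in> H"
        using h by simp
      moreover have "s \<otimes> inv (x \<otimes> h) \<otimes> h = s \<otimes> inv x"
        using x h ScH[OF that] by (simp add: inv_mult m_assoc)
      ultimately show False
        using miss[OF that] by simp
    qed
    then have "x \<otimes> h \<in> S"
      using x h xhH xh by (intro add_pair) auto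
    moreover have "(x \<otimes> h) \<otimes> inv x = h"
      using x h m_comm[of x h] by (simp add: m_assoc)
    ultimately show False
      using miss[of "x \<otimes> h"] h by simp
  qed
  have "\<one> \<notin> S"
    using ScH(2) H.one_closed by blast
  then have "connection_set G S"
    using ScH(1) Sinv by (auto simp: connection_set_def)
  moreover have "graph_perfect_code (with_proj (cayley_graph G S)) H"
    unfolding graph_perfect_code_def independent_vertices_def
  proof (intro conjI ballI)
    show "H \<subseteq> verts (with_proj (cayley_graph G S))"
      by (simp add: cayley_graph_def H.subset)
    show "\<not> u \<rightarrow>\<^bsub>with_proj (cayley_graph G S)\<^esub> v" if "u \<in> H" "v \<in> H" for u v
      using that ScH unfolding adj_cayley_graph by auto
    fix v assume "v \<in> verts (with_proj (cayley_graph G S)) - H"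
    then have v: "v \<in> carrier G" "v \<notin> H"
      by (auto simp: cayley_graph_def)
    \<comment> \<open>A neighbour of \<open>v\<close> in \<open>H\<close> has the form
      \<open>s \<otimes> v\<close> with \<open>s\<close> in \<open>S\<close>, so \<open>s\<close>
      must lie in the coset of \<open>inv v\<close>, not of \<open>v\<close>.\<close>
    then have iv: "inv v \<in> carrier G" "inv v \<notin> H"
      by (auto, metis H.m_inv_closed inv_inv)
    from exS[OF this] obtain s where s: "s \<in> S" "s \<otimes> v \<in> H"
      using v by auto
    show "\<exists>!c. c \<in> H \<and> v \<rightarrow>\<^bsub>with_proj (cayley_graph G S)\<^esub> c"
    proof (rule ex1I[of _ "s \<otimes> v"])
      show "s \<otimes> v \<in> H \<and> v \<rightarrow>\<^bsub>with_proj (cayley_graph G S)\<^esub> (s \<otimes> v)"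
        using s v ScH unfolding adj_cayley_graph by (auto simp: m_assoc)
      fix c assume "c \<in> H \<and> v \<rightarrow>\<^bsub>with_proj (cayley_graph G S)\<^esub> c"
      then have c: "c \<in> H" "c \<otimes> inv v \<in> S" "c \<in> carrier G"
        unfolding adj_cayley_graph by auto
      have "(c \<otimes> inv v) \<otimes> inv s = c \<otimes> inv (s \<otimes> v)"
        using c v s ScH by (simp add: inv_mult m_ac)
      then have "c \<otimes> inv v = s"
        using c s by (intro Suniq) auto
      then show "c = s \<otimes> v"
        using c v by (auto simp: m_assoc)
    qed
  qed
  ultimately show ?thesis
    by (auto simp: group_perfect_code_def)
qed

section \<open>Perfect codes from odd order and from maximal order\<close>

text \<open>With \<open>card H = 2 * k + 1\<close>, the witness is the \<open>k\<close>-th power of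
  \<open>g \<otimes> g\<close>: it turns \<open>g\<close> into \<open>g [^] card H\<close>, whose
  square is the \<open>card H\<close>-th power of an element of \<open>H\<close> and hence
  trivial.\<close>

lemma (in comm_group) odd_order_subgroup_perfect_code:
  assumes "finite (carrier G)" "subgroup H G" "odd (card H)"
  shows "group_perfect_code G H"
proof (rule involution_in_cosets_imp_perfect_code)
  interpret H: subgroup H G by fact
  fix g assume g: "g \<in> carrier G" "g \<otimes> g \<in> H"
  obtain k where k: "card H = 2 * k + 1"
    using assms(3) by (elim oddE)
  have "(g \<otimes> g) [^] card H = (g \<otimes> g) [^]\<^bsub>G\<lparr>carrier := H\<rparr>\<^esub> card H"
    by (rule nat_pow_consistent)
  also have "\<dots> = \<one>"
    using group.pow_order_eq_1[OF H.subgroup_is_group[OF group_axioms], of "g \<otimes> g"] g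
    by (simp add: order_def)
  finally have "(g \<otimes> g) [^] card H = \<one>" .
  moreover have "g \<otimes> (g \<otimes> g) [^] k = g [^] card H"
  proof -
    have "(g \<otimes> g) [^] k = g [^] (2 * k)"
      using g nat_pow_pow[of g 2 k] by (simp add: numeral_2_eq_2)
    then show ?thesis
      using g by (simp add: k m_comm)
  qed
  moreover have "g [^] card H \<otimes> g [^] card H = (g \<otimes> g) [^] card H"
    using g by (simp add: pow_mult_distrib)
  ultimately have "(g \<otimes> (g \<otimes> g) [^] k) \<otimes> (g \<otimes> (g \<otimes> g) [^] k) = \<one>"
    by simp
  moreover have "(g \<otimes> g) [^] k \<in> H"
    using g subgroup_int_pow_closed[OF assms(2), of "g \<otimes> g" "int k"] by (simp add: int_pow_int)
  ultimately show "\<exists>h\<in>H. (g \<otimes> h) \<otimes> (g \<otimes> h) = \<one>"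
    by blast
qed (use assms in auto)

lemma (in group) cyclic_iso_integer_mod_group:
  assumes fin: "finite (carrier G)" and x: "x \<in> carrier G" and gen: "generate G {x} = carrier G"
  shows "G \<cong> integer_mod_group (order G)"
proof -
  have n: "ord x = order G"
    using generate_pow_card[OF x] gen by (simp add: order_def)
  have pos: "order G > 0"
    using fin order_gt_0_iff_finite by blast
  \<comment> \<open>Exponents matter only modulo \<open>ord x\<close>, so
    \<open>k \<mapsto> x [^] k\<close> respects addition of residues.\<close>
  have red: "x [^] (k mod int (order G)) = x [^] k" for k :: int
    using x by (simp add: n int_pow_eq)
  let ?f = "\<lambda>k::int. x [^] k"
  have "?f \<in> hom (integer_mod_group (order G)) G"
    using x by (auto simp: hom_def red int_pow_mult)
  moreover have "carrier G \<subseteq> ?f ` carrier (integer_mod_group (order G))"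
  proof
    fix y assume "y \<in> carrier G"
    then obtain k :: int where "y = x [^] k"
      using generate_pow[OF x] gen by auto
    then show "y \<in> ?f ` carrier (integer_mod_group (order G))"
      using pos by (intro image_eqI[of _ _ "k mod int (order G)"])
        (auto simp: red carrier_integer_mod_group)
  qed
  then have surj: "?f ` carrier (integer_mod_group (order G)) = carrier G"
    using x by auto
  moreover have "inj_on ?f (carrier (integer_mod_group (order G)))"
    using surj pos by (intro eq_card_imp_inj_on)
      (auto simp: carrier_integer_mod_group order_def)
  ultimately have "integer_mod_group (order G) \<cong> G"
    unfolding is_iso_def iso_def bij_betw_def by blast
  then show ?thesis
    by (simp add: group.iso_sym)
qed

text \<open>Write \<open>g \<otimes> g = x [^] j\<close>. For odd \<open>j\<close> this square would
  have the order of \<open>x\<close>, so \<open>g\<close> would have twice that order, against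
  maximality. Hence \<open>j = i + i\<close>, and \<open>g \<otimes> inv (x [^] i)\<close> has
  trivial square.\<close>

lemma (in comm_group) generate_max_ord_perfect_code:
  assumes fin: "finite (carrier G)" and x: "x \<in> carrier G" and ord_x: "ord x = 2 ^ k" "k > 0"
    and max: "\<And>y. y \<in> carrier G \<Longrightarrow> ord y \<le> ord x"
  shows "group_perfect_code G (generate G {x})"
proof (rule involution_in_cosets_imp_perfect_code[OF fin])
  show sub: "subgroup (generate G {x}) G"
    using x by (intro generate_is_subgroup) auto
  fix g assume g: "g \<in> carrier G" "g \<otimes> g \<in> generate G {x}"
  obtain j :: nat where j: "g \<otimes> g = x [^] j"
    using g generate_pow_on_finite_carrier[OF fin x] by auto
  have "even j"
  proof (rule ccontr)
    assume "odd j"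
    then have "coprime (ord x) j"
      using ord_x by simp
    then have "ord (g [^] (2::nat)) = ord x"
      using ord_pow_gen[OF x, of j] \<open>odd j\<close> j g by (auto simp: numeral_2_eq_2 elim: oddE)
    then have eq: "ord g div gcd (ord g) 2 = ord x"
      using ord_pow_gen[OF g(1), of 2] by simp
    \<comment> \<open>Squaring preserves an odd order, so \<open>ord g\<close> would equal the even
      number \<open>ord x\<close>.\<close>
    have "even (ord g)"
    proof (rule ccontr)
      assume "odd (ord g)"
      then have "gcd (ord g) 2 = 1"
        by (simp flip: coprime_iff_gcd_eq_1)
      then show False
        using eq ord_x \<open>odd (ord g)\<close> by simp
    qed
    then have "ord g = 2 * ord x"
      using eq by (metis dvd_mult_div_cancel gcd_nat.absorb2)
    then show False
      using max[OF g(1)] ord_x by simp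
  qed
  then obtain i where i: "j = i + i"
    by (metis evenE mult_2)
  have "(g \<otimes> inv (x [^] i)) \<otimes> (g \<otimes> inv (x [^] i)) = (g \<otimes> g) \<otimes> inv (x [^] i \<otimes> x [^] i)"
    using g x by (simp add: inv_mult m_ac)
  also have "\<dots> = \<one>"
    using x by (simp add: j i nat_pow_mult)
  finally have "(g \<otimes> inv (x [^] i)) \<otimes> (g \<otimes> inv (x [^] i)) = \<one>" .
  moreover have "inv (x [^] i) \<in> generate G {x}"
    using generate_pow_on_finite_carrier[OF fin x] by (intro subgroup.m_inv_closed[OF sub]) auto
  ultimately show "\<exists>h\<in>generate G {x}. (g \<otimes> h) \<otimes> (g \<otimes> h) = \<one>"
    by blast
qed

section \<open>The two directions of the equivalence\<close>

lemma (in comm_group) no_perfect_code_imp_cyclic_2_group: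
  assumes fin: "finite (carrier G)" and ord1: "order G > 1" and nsimple: "\<not> simple_group G"
    and no_code: "\<And>H. subgroup H G \<Longrightarrow> H \<noteq> {\<one>} \<Longrightarrow> H \<noteq> carrier G \<Longrightarrow> \<not> group_perfect_code G H"
  shows "\<exists>m\<ge>2. G \<cong> integer_mod_group (2 ^ m)"
proof -
  have gen_sub: "subgroup (generate G {x}) G" if "x \<in> carrier G" for x
    using that by (intro generate_is_subgroup) auto
  have gen_nontriv: "generate G {x} \<noteq> {\<one>}" if "x \<noteq> \<one>" for x
    using generate.incl[of x "{x}" G] that by auto
  obtain K where K: "subgroup K G" "K \<noteq> {\<one>}" "K \<noteq> carrier G"
    using nsimple ord1 group_axioms
    by (auto simp: simple_group_def simple_group_axioms_def dest: normal_imp_subgroup)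
  \<comment> \<open>Non-simplicity enters here: the proper subgroup \<open>K\<close> makes the order
    of \<open>G\<close> even, so that a cyclic subgroup of odd order cannot be all of
    \<open>G\<close>.\<close>
  have "even (card K)"
    using odd_order_subgroup_perfect_code[OF fin K(1)] no_code[OF K] by blast
  then have even_order: "even (order G)"
    using lagrange[OF K(1)] by (metis dvd_mult)
  have odd_ord: "x = \<one>" if x: "x \<in> carrier G" "odd (ord x)" for x
  proof (rule ccontr)
    assume "x \<noteq> \<one>"
    have card: "card (generate G {x}) = ord x"
      using generate_pow_card[OF x(1)] by simp
    have "group_perfect_code G (generate G {x})"
      using odd_order_subgroup_perfect_code[OF fin gen_sub] x card by simp
    then have "generate G {x} = carrier G"
      using no_code[OF gen_sub[OF x(1)] gen_nontriv[OF \<open>x \<noteq> \<one>\<close>]] by blast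
    then show False
      using card x(2) even_order by (simp add: order_def)
  qed
  have ord_pow2: "\<exists>k. ord x = 2 ^ k" if x: "x \<in> carrier G" for x
  proof -
    have pos: "ord x > 0"
      using ord_ge_1[OF fin x] by simp
    obtain a b where ab: "ord x = 2 ^ a * b" "odd b"
    proof (rule multiplicity_decompose'[of "ord x" 2])
      show "ord x \<noteq> 0"
        using pos by simp
    qed auto
    \<comment> \<open>Raising \<open>x\<close> to the 2-part of its order leaves an element whose
      order is the odd part \<open>b\<close>.\<close>
    have "ord (x [^] ((2::nat) ^ a)) = b"
      using ord_pow[OF x, of "2 ^ a"] ab by simp
    then have "b = 1"
      using odd_ord[of "x [^] ((2::nat) ^ a)"] ab x by auto
    then show ?thesis
      using ab by auto
  qed
  have "finite (ord ` carrier G)" "ord ` carrier G \<noteq> {}"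
    using fin by auto
  then obtain x where x: "x \<in> carrier G" and max: "\<And>y. y \<in> carrier G \<Longrightarrow> ord y \<le> ord x"
    using Max_in[of "ord ` carrier G"] Max_ge[of "ord ` carrier G"] by fastforce
  obtain k where k: "ord x = 2 ^ k"
    using ord_pow2[OF x] by blast
  have "x \<noteq> \<one>"
  proof
    assume "x = \<one>"
    then have "y = \<one>" if "y \<in> carrier G" for y
      using max[OF that] ord_eq_1[OF that] ord_ge_1[OF fin that] by simp
    then have "carrier G = {\<one>}"
      by auto
    then show False
      using ord1 by (simp add: order_def)
  qed
  then have "k > 0"
    using k ord_eq_1[OF x] by (cases k) auto
  have gen: "generate G {x} = carrier G"
    using generate_max_ord_perfect_code[OF fin x k \<open>k > 0\<close> max]
      no_code[OF gen_sub[OF x] gen_nontriv[OF \<open>x \<noteq> \<one>\<close>]] by blast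
  then have order: "order G = 2 ^ k"
    using generate_pow_card[OF x] k by (simp add: order_def)
  \<comment> \<open>A group of prime order 2 would be simple.\<close>
  have "k \<noteq> 1"
    using prime_order_simple nsimple order by auto
  then have "k \<ge> 2"
    using \<open>k > 0\<close> by simp
  then show ?thesis
    using cyclic_iso_integer_mod_group[OF fin x gen] order by auto
qed

text \<open>The isomorphism \<open>f\<close> is used to show that \<open>G\<close> has at most one
  involution. A nontrivial \<open>H\<close> contains one, hence every solution of
  \<open>z \<otimes> z = \<one>\<close>, while some \<open>g\<close> outside a proper
  \<open>H\<close> has its square in \<open>H\<close>.\<close>

lemma (in comm_group) cyclic_2_group_imp_no_perfect_code:
  assumes iso: "G \<cong> integer_mod_group (2 ^ m)"
    and H: "subgroup H G" "H \<noteq> {\<one>}" "H \<noteq> carrier G"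
  shows "\<not> group_perfect_code G H"
proof
  assume pc: "group_perfect_code G H"
  interpret H: subgroup H G by fact
  obtain f where f: "f \<in> iso G (integer_mod_group (2 ^ m))"
    using iso by (auto simp: is_iso_def)
  then have bij: "bij_betw f (carrier G) {0..<2 ^ m}"
    by (simp add: iso_def carrier_integer_mod_group)
  have hom: "f (a \<otimes> b) = (f a + f b) mod 2 ^ m" if "a \<in> carrier G" "b \<in> carrier G" for a b
    using f that by (simp add: iso_def hom_def)
  have f1: "f \<one> = 0"
    using hom_one[of f G "integer_mod_group (2 ^ m)"] f by (simp add: iso_def)
  have order: "order G = 2 ^ m"
    using bij_betw_same_card[OF bij] by (simp add: order_def nat_power_eq)
  have pow_1: "x [^] ((2::nat) ^ m) = \<one>" if "x \<in> carrier G" for x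
    using pow_order_eq_1[OF that] order by simp
  \<comment> \<open>Repeated squaring of \<open>x\<close> reaches \<open>\<one>\<close> and so
    enters \<open>N\<close>; the last power outside \<open>N\<close> is the one wanted. It is used
    with \<open>N = {\<one>}\<close> to find an involution, which stays in \<open>H\<close> because
    it is a power of \<open>x\<close>, and with \<open>N = H\<close> to find
    \<open>g\<close>.\<close>
  have root: "\<exists>y\<in>carrier G. y \<notin> N \<and> y \<otimes> y \<in> N \<and> (\<exists>i::nat. y = x [^] i)"
    if N: "\<one> \<in> N" and x: "x \<in> carrier G" "x \<notin> N" for N x
  proof -
    define i where "i = (LEAST i. x [^] ((2::nat) ^ i) \<in> N)"
    have i: "x [^] ((2::nat) ^ i) \<in> N"
      unfolding i_def by (rule LeastI[of _ m]) (simp add: pow_1 x N)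
    then obtain l where l: "i = Suc l"
      using x by (cases i) auto
    then have "x [^] ((2::nat) ^ l) \<notin> N"
      using not_less_Least[of l "\<lambda>i. x [^] ((2::nat) ^ i) \<in> N"] by (simp add: i_def)
    moreover have "x [^] ((2::nat) ^ l) \<otimes> x [^] ((2::nat) ^ l) \<in> N"
      using i x by (simp add: l nat_pow_mult mult_2)
    ultimately show ?thesis
      using x by (intro bexI[of _ "x [^] ((2::nat) ^ l)"]) auto
  qed
  obtain x where "x \<in> H" "x \<noteq> \<one>"
    using H.one_closed H(2) by blast
  then obtain t where t: "t \<in> H" "t \<noteq> \<one>" "t \<otimes> t = \<one>"
    using root[of "{\<one>}" x] subgroup_int_pow_closed[OF H(1), of x "int i" for i]
    by (auto simp: int_pow_int)
  \<comment> \<open>The number \<open>2 * f z\<close> is a multiple of \<open>2 ^ m\<close> below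
    \<open>2 * 2 ^ m\<close>, so only two values remain.\<close>
  have sq_zero: "f z = 0 \<or> 2 * f z = 2 ^ m" if z: "z \<in> carrier G" "z \<otimes> z = \<one>" for z
  proof -
    have "0 \<le> f z" "f z < 2 ^ m"
      using bij_betwE[OF bij] z by auto
    moreover have "(2::int) ^ m dvd 2 * f z"
      using hom[of z z] z f1 by (simp add: mod_eq_0_iff_dvd)
    then obtain q where q: "2 * f z = 2 ^ m * q"
      by (elim dvdE)
    ultimately have "0 \<le> 2 ^ m * q" "2 ^ m * q < 2 ^ m * 2"
      by linarith+
    then have "q = 0 \<or> q = 1"
      by (auto simp: zero_le_mult_iff)
    then show ?thesis
      using q by auto
  qed
  have inj: "a = b" if "f a = f b" "a \<in> carrier G" "b \<in> carrier G" for a b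
    using bij that by (auto simp: bij_betw_def inj_on_def)
  have invol: "z \<in> H" if z: "z \<in> carrier G" "z \<otimes> z = \<one>" for z
  proof -
    have "f t \<noteq> 0"
      using inj[of t \<one>] f1 t by auto
    then have "f z = f \<one> \<or> f z = f t"
      using sq_zero[of t] sq_zero[of z] t z f1 by auto
    then show ?thesis
      using inj[of z \<one>] inj[of z t] z t by auto
  qed
  obtain y where "y \<in> carrier G" "y \<notin> H"
    using H(3) H.subset by blast
  then obtain g where g: "g \<in> carrier G" "g \<notin> H" "g \<otimes> g \<in> H"
    using root[of H y] by auto
  \<comment> \<open>The code property would give \<open>g \<otimes> h\<close> trivial square, so
    \<open>g \<otimes> h\<close> and with it \<open>g\<close> would lie in \<open>H\<close>.\<close>
  then obtain h where h: "h \<in> H" "(g \<otimes> h) \<otimes> (g \<otimes> h) = \<one>"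
    using perfect_code_imp_involution_in_coset[OF H(1) pc] by blast
  then have "(g \<otimes> h) \<otimes> inv h \<in> H"
    using invol[of "g \<otimes> h"] g by simp
  then show False
    using g h by (simp add: m_assoc)
qed

theorem theorem1p6:
  fixes G (structure)
  assumes "comm_group G"
    and "finite (carrier G)"
    and "order G > 1"
    and "\<not> simple_group G"
  shows "(\<forall>H. subgroup H G \<and> H \<noteq> {\<one>} \<and> H \<noteq> carrier G \<longrightarrow> \<not> group_perfect_code G H)
     \<longleftrightarrow> (\<exists>m\<ge>2. G \<cong> integer_mod_group (2 ^ m))"
proof -
  interpret comm_group G by fact
  show ?thesis
    using no_perfect_code_imp_cyclic_2_group[OF assms(2-4)] cyclic_2_group_imp_no_perfect_code
    by blast
qed

end
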